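(* (Provable in ZFC, with no additional set-theoretic hypotheses.) There exist a concept class $\mathcal{C}$ on $[0,1]$, all of whose members are Borel sets, with $\operatorname{VCdim}(\mathcal{C})=1$, a consistent learning rule $L=(L_n)_{n\ge1}$ for $\mathcal{C}$, a Borel probability measure $\mu$ on $[0,1]$, and a target concept $C\in\mathcal{C}$ such that for every $n\ge1$, $$(\mu^{\otimes n})^*\bigl(\{s\in[0,1]^n : \mu(L_n(S_C(s))\mathbin{\triangle}C)=1\}\bigr)=1.$$ That is, the rule has true risk one at every sample size on a set of samples of outer probability one.
   Context: Let $X=[0,1]$ with its usual topology. A concept is a subset of $X$, and a concept class $\mathcal{C}$ on $X$ is a collection of concepts. VC dimension: for a finite set $F\subseteq X$, the trace of $\mathcal{C}$ on $F$ is $\{H\cap F: H\in\mathcal{C}\}$; $F$ is shattered by $\mathcal{C}$ if its trace equals the power set $\mathcal{P}(F)$. Then $\operatorname{VCdim}(\mathcal{C})=\sup\{|F|: F\subseteq X \text{ finite and shattered by } \mathcal{C}\}$. Labeled samples: write $\mathbf{1}_A$ for the characteristic function of $A\subseteq X$. For $C\in\mathcal{C}$ and $s=(x_1,\dots,x_n)\in X^n$, put $S_C(s)=((x_1,\mathbf{1}_C(x_1)),\dots,(x_n,\mathbf{1}_C(x_n)))\in (X\times\{0,1\})^n$. Learning rule: a learning rule for $\mathcal{C}$ is a sequence $L=(L_n)_{n\ge1}$ of arbitrary maps $L_n:(X\times\{0,1\})^n\to\mathcal{C}$. It is consistent if for every $C\in\mathcal{C}$, every $n\ge1$ and every $s=(x_1,\dots,x_n)\in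 X^n$, one has $x_i\in L_n(S_C(s))\iff x_i\in C$ for all $i=1,\dots,n$. The true risk of $L$ with respect to $C$, $\mu$, $n$ at $s\in X^n$ is $\mu(L_n(S_C(s))\mathbin{\triangle}C)$, where $\triangle$ is symmetric difference. $\mu^{\otimes n}$ is the product probability measure on the Borel sets of $X^n$, and $(\mu^{\otimes n})^*$ is the outer measure it induces. *)

theory Defs
  imports "HOL-Analysis.Analysis" "HOL-Probability.Probability" "HOL-Library.Extended_Nat"
begin

definition concept_class :: "'a set \<Rightarrow> 'a set set \<Rightarrow> bool" where
  "concept_class X \<C> \<longleftrightarrow> \<C> \<subseteq> Pow X"

definition trace_on :: "'a set set \<Rightarrow> 'a set \<Rightarrow> 'a set set" where
  "trace_on \<C> F = {H \<inter> F | H. H \<in> \<C>}"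

definition shattered :: "'a set set \<Rightarrow> 'a set \<Rightarrow> bool" where
  "shattered \<C> F \<longleftrightarrow> trace_on \<C> F = Pow F"

definition VCdim :: "'a set \<Rightarrow> 'a set set \<Rightarrow> enat" where
  "VCdim X \<C> = (SUP F \<in> {F. F \<subseteq> X \<and> finite F \<and> shattered \<C> F}. enat (card F))"

text \<open>
  An \<open>n\<close>-tuple over a set is an extensional function on \<open>{1..n}\<close>; this is the carrier
  of the product measure \<open>PiM {1..n}\<close>.
\<close>

definition tuples :: "nat \<Rightarrow> 'a set \<Rightarrow> (nat \<Rightarrow> 'a) set" where
  "tuples n X = ({1..n} \<rightarrow>\<^sub>E X)"

definition labeled_sample :: "nat \<Rightarrow> 'a set \<Rightarrow> (nat \<Rightarrow> 'a) \<Rightarrow> (nat \<Rightarrow> 'a \<times> nat)" where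
  "labeled_sample n C s = (\<lambda>i\<in>{1..n}. (s i, indicator C (s i)))"

text \<open>Only the values of \<open>L n\<close> for \<open>n \<ge> 1\<close> on tuples over \<open>X \<times> {0, 1}\<close> are relevant.\<close>

definition learning_rule ::
  "'a set \<Rightarrow> 'a set set \<Rightarrow> (nat \<Rightarrow> (nat \<Rightarrow> 'a \<times> nat) \<Rightarrow> 'a set) \<Rightarrow> bool" where
  "learning_rule X \<C> L \<longleftrightarrow> (\<forall>n\<ge>1. L n \<in> tuples n (X \<times> {0, 1}) \<rightarrow> \<C>)"

definition consistent_rule ::
  "'a set \<Rightarrow> 'a set set \<Rightarrow> (nat \<Rightarrow> (nat \<Rightarrow> 'a \<times> nat) \<Rightarrow> 'a set) \<Rightarrow> bool" where
  "consistent_rule X \<C> L \<longleftrightarrow>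
    (\<forall>C\<in>\<C>. \<forall>n\<ge>1. \<forall>s\<in>tuples n X. \<forall>i\<in>{1..n}.
      s i \<in> L n (labeled_sample n C s) \<longleftrightarrow> s i \<in> C)"

definition true_risk ::
  "(nat \<Rightarrow> (nat \<Rightarrow> 'a \<times> nat) \<Rightarrow> 'a set) \<Rightarrow> 'a set \<Rightarrow> 'a measure \<Rightarrow> nat \<Rightarrow> (nat \<Rightarrow> 'a) \<Rightarrow> real" where
  "true_risk L C \<mu> n s = measure \<mu> (sym_diff (L n (labeled_sample n C s)) C)"

end

theory Submission
  imports Defs
begin

text \<open>
  The class consists of the empty set, which is the target, and of the complements in \<open>[0,1]\<close> of
  the members of a chain \<open>K\<close> of Borel sets of Lebesgue measure zero. A class that is a chain under
  inclusion has VC dimension at most one. A rule that sees only the label \<open>0\<close>, on points that all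
  lie in one \<open>N \<in> K\<close>, may consistently answer with the complement of \<open>N\<close>. That hypothesis has
  measure one, whereas the target is empty. Since \<open>K\<close> is a chain, the points of any finite sample
  from \<open>U = \<Union>K\<close> do lie in a common member of \<open>K\<close>, so the rule has risk one on all of \<open>U\<^sup>n\<close>.

  It remains to make \<open>U\<close> large, although it is the union of a chain of null sets. A maximal chain
  \<open>K\<close>, given by Hausdorff's principle, suffices: a null set \<open>G \<supseteq> U\<close> could be
  enlarged by a point outside it, and the result would extend \<open>K\<close>. Hence \<open>U\<close> has positive outer
  measure (lemma \<open>chain_null_sets_Union_not_null\<close>). Conditioning Lebesgue measure on a measurable hull of \<open>U\<close> gives a measure
  \<open>\<mu>\<close> for which \<open>U\<close> has outer measure one and the members of \<open>K\<close> are still null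
  (lemma \<open>uniform_measure_hull\<close>), and Fubini's theorem passes full outer measure from \<open>U\<close>
  to \<open>U\<^sup>n\<close> (lemma \<open>outer_measure_of_PiM_PiE_eq_1\<close>).
\<close>

section \<open>VC dimension of chains of concepts\<close>

text \<open>
  No two points \<open>a\<close> and \<open>b\<close> are shattered, because concepts cutting out \<open>{a}\<close> and \<open>{b}\<close> would be
  incomparable. The point \<open>x\<close> excludes dimension zero.
\<close>
lemma VCdim_chain_eq_1:
  assumes chain: "subset.chain (Pow X) \<C>"
    and x: "x \<in> X" and A: "A \<in> \<C>" "x \<in> A" and B: "B \<in> \<C>" "x \<notin> B"
  shows "VCdim X \<C> = 1"
proof (rule antisym)
  have "card F \<le> 1" if "finite F" and sh: "shattered \<C> F" for F
  proof (rule ccontr)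
    assume "\<not> card F \<le> 1"
    then obtain a b where ab: "a \<in> F" "b \<in> F" "a \<noteq> b"
      using \<open>finite F\<close> by (metis One_nat_def card_le_Suc0_iff_eq)
    then have "{a} \<in> trace_on \<C> F" "{b} \<in> trace_on \<C> F"
      using sh by (auto simp: shattered_def)
    then obtain H H' where H: "H \<in> \<C>" "{a} = H \<inter> F" and H': "H' \<in> \<C>" "{b} = H' \<inter> F"
      by (auto simp: trace_on_def)
    then have "H \<subseteq> H' \<or> H' \<subseteq> H"
      using chain by (auto simp: subset_chain_def)
    moreover have "a \<in> H \<inter> F" "b \<notin> H \<inter> F" "a \<notin> H' \<inter> F" "b \<in> H' \<inter> F"
      unfolding H(2)[symmetric] H'(2)[symmetric] using ab by simp_all
    ultimately show False
      using ab by auto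
  qed
  then show "VCdim X \<C> \<le> 1"
    unfolding VCdim_def by (intro SUP_least) (auto simp: one_enat_def)
next
  have "H \<inter> {x} \<in> trace_on \<C> {x}" if "H \<in> \<C>" for H
    using that by (auto simp: trace_on_def)
  from this[OF A(1)] this[OF B(1)] have "Pow {x} \<subseteq> trace_on \<C> {x}"
    using A(2) B(2) by (simp add: Pow_insert)
  moreover have "trace_on \<C> {x} \<subseteq> Pow {x}"
    unfolding trace_on_def by blast
  ultimately have "shattered \<C> {x}"
    by (simp add: shattered_def)
  then have "{x} \<in> {F. F \<subseteq> X \<and> finite F \<and> shattered \<C> F}"
    using x by simp
  from SUP_upper[OF this, of "\<lambda>F. enat (card F)"] show "1 \<le> VCdim X \<C>"
    by (simp add: VCdim_def one_enat_def)
qed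

section \<open>A consistent rule that avoids the empty concept\<close>

definition fits :: "nat \<Rightarrow> (nat \<Rightarrow> 'a \<times> nat) \<Rightarrow> 'a set \<Rightarrow> bool" where
  "fits n t H \<longleftrightarrow> (\<forall>i\<in>{1..n}. fst (t i) \<in> H \<longleftrightarrow> snd (t i) = 1)"

text \<open>
  The fallback \<open>{}\<close> is also correct for samples labelled by a member of the class: if no nonempty
  member fits, then the labels came from \<open>{}\<close> itself.
\<close>
definition nonempty_rule :: "'a set set \<Rightarrow> nat \<Rightarrow> (nat \<Rightarrow> 'a \<times> nat) \<Rightarrow> 'a set" where
  "nonempty_rule \<C> n t =
    (if \<exists>H\<in>\<C>. H \<noteq> {} \<and> fits n t H then SOME H. H \<in> \<C> \<and> H \<noteq> {} \<and> fits n t H else {})"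

lemma nonempty_rule_fits:
  assumes "H \<in> \<C>" "H \<noteq> {}" "fits n t H"
  shows "nonempty_rule \<C> n t \<in> \<C>" "nonempty_rule \<C> n t \<noteq> {}" "fits n t (nonempty_rule \<C> n t)"
proof -
  have ex: "\<exists>H\<in>\<C>. H \<noteq> {} \<and> fits n t H"
    using assms by blast
  then have "\<exists>H. H \<in> \<C> \<and> H \<noteq> {} \<and> fits n t H"
    by blast
  from someI_ex[OF this] ex
  show "nonempty_rule \<C> n t \<in> \<C>" "nonempty_rule \<C> n t \<noteq> {}" "fits n t (nonempty_rule \<C> n t)"
    unfolding nonempty_rule_def by simp_all
qed

lemma fits_labeled_sample:
  "fits n (labeled_sample n C s) H \<longleftrightarrow> (\<forall>i\<in>{1..n}. s i \<in> H \<longleftrightarrow> s i \<in> C)"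
  by (auto simp: fits_def labeled_sample_def indicator_def)

lemma learning_rule_nonempty_rule:
  assumes "{} \<in> \<C>"
  shows "learning_rule X \<C> (nonempty_rule \<C>)"
proof -
  have "nonempty_rule \<C> n t \<in> \<C>" for n t
  proof (cases "\<exists>H\<in>\<C>. H \<noteq> {} \<and> fits n t H")
    case True
    then show ?thesis
      using nonempty_rule_fits(1) by blast
  next
    case False
    then have "nonempty_rule \<C> n t = {}"
      unfolding nonempty_rule_def by (rule if_not_P)
    then show ?thesis
      using assms by simp
  qed
  then show ?thesis
    by (simp add: learning_rule_def)
qed

lemma consistent_nonempty_rule: "consistent_rule X \<C> (nonempty_rule \<C>)"
proof -
  have "fits n (labeled_sample n C s) (nonempty_rule \<C> n (labeled_sample n C s))"
    if C: "C \<in> \<C>" for C n s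
  proof (cases "\<exists>H\<in>\<C>. H \<noteq> {} \<and> fits n (labeled_sample n C s) H")
    case True
    then show ?thesis
      using nonempty_rule_fits(3) by blast
  next
    case False
    have fits: "fits n (labeled_sample n C s) C"
      by (simp add: fits_labeled_sample)
    with False C have "C = {}"
      by blast
    moreover have "nonempty_rule \<C> n (labeled_sample n C s) = {}"
      unfolding nonempty_rule_def using False by (rule if_not_P)
    ultimately show ?thesis
      using fits by simp
  qed
  then show ?thesis
    by (auto simp: consistent_rule_def fits_labeled_sample)
qed

section \<open>Sets of full outer measure\<close>

text \<open>
  Take \<open>K\<close> maximal. Since points are null, a null set \<open>G \<supseteq> \<Union>K\<close> can be enlarged by any point of the
  space, and by maximality the enlarged set still equals \<open>\<Union>K\<close>; so \<open>G\<close> would be the whole space.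
\<close>
lemma chain_null_sets_Union_not_null:
  assumes space: "emeasure M (space M) \<noteq> 0"
    and point: "\<And>x. x \<in> space M \<Longrightarrow> {x} \<in> null_sets M"
  obtains K where "subset.chain (null_sets M) K"
    and "\<And>G. G \<in> null_sets M \<Longrightarrow> \<not> \<Union>K \<subseteq> G"
proof -
  obtain K where K: "subset.maxchain (null_sets M) K"
    using subset.Hausdorff by blast
  have "\<not> \<Union>K \<subseteq> G" if G: "G \<in> null_sets M" for G
  proof
    assume sub: "\<Union>K \<subseteq> G"
    have "space M \<subseteq> G"
    proof
      fix x assume "x \<in> space M"
      then have "{x} \<union> G \<in> null_sets M"
        using point G by (intro null_sets.Un) auto
      then have "\<Union>K = {x} \<union> G"
        using subset_maxchain_max[OF K] sub by blast
      then show "x \<in> G"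
        using sub by blast
    qed
    moreover have "G \<subseteq> space M"
      using G by (auto dest: sets.sets_into_space)
    ultimately show False
      using G space by auto
  qed
  then show thesis
    using that K subset.maxchain_imp_chain by blast
qed

text \<open>
  The measure is \<open>M\<close> conditioned on a measurable hull \<open>B\<close> of \<open>U\<close>: any measurable \<open>A \<supseteq> U\<close> contains
  \<open>B\<close> up to a null set, as otherwise \<open>A \<inter> B\<close> would be a smaller hull.
\<close>
lemma (in finite_measure) uniform_measure_hull:
  assumes U: "U \<subseteq> space M" and not_null: "\<And>G. G \<in> null_sets M \<Longrightarrow> \<not> U \<subseteq> G"
  obtains \<mu> where "prob_space \<mu>" and "sets \<mu> = sets M" and "null_sets M \<subseteq> null_sets \<mu>"
    and "outer_measure_of \<mu> U = 1"
proof -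
  obtain B where B: "B \<in> sets M" "U \<subseteq> B" "outer_measure_of M U = emeasure M B"
    using outer_measure_of_attain[OF U] by blast
  have pos: "emeasure M B \<noteq> 0"
    using not_null[of B] B by blast
  have fin: "emeasure M B \<noteq> \<infinity>"
    by simp
  let ?\<mu> = "uniform_measure M B"
  show thesis
  proof
    show "prob_space ?\<mu>"
      using pos fin by (rule prob_space_uniform_measure)
    show "null_sets M \<subseteq> null_sets ?\<mu>"
    proof
      fix N assume N: "N \<in> null_sets M"
      then have "emeasure M (B \<inter> N) = 0"
        using B(1) by (metis null_setsD1 null_set_Int1)
      then show "N \<in> null_sets ?\<mu>"
        using N B(1) by (auto simp: null_sets_def)
    qed
    have "emeasure ?\<mu> A = 1" if A: "A \<in> sets M" "U \<subseteq> A" for A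
    proof -
      have "emeasure M B \<le> emeasure M (B \<inter> A)"
        using outer_measure_of_mono[of U "B \<inter> A" M] A B by simp
      moreover have "emeasure M (B \<inter> A) \<le> emeasure M B"
        using B by (intro emeasure_mono) auto
      ultimately have "emeasure M (B \<inter> A) = emeasure M B"
        by (rule antisym[rotated])
      then show ?thesis
        using A B pos fin by (simp add: less_top[symmetric])
    qed
    then have "(\<lambda>A. emeasure ?\<mu> A) ` {A \<in> sets ?\<mu>. U \<subseteq> A} = {1}"
      using B by auto
    then show "outer_measure_of ?\<mu> U = 1"
      by (simp add: outer_measure_of_def)
  qed simp
qed

lemma (in prob_space) outer_measure_of_eq_1_iff:
  assumes "U \<subseteq> space M"
  shows "outer_measure_of M U = 1 \<longleftrightarrow> (\<forall>A\<in>sets M. U \<subseteq> A \<longrightarrow> emeasure M A = 1)"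
proof
  assume 1: "outer_measure_of M U = 1"
  show "\<forall>A\<in>sets M. U \<subseteq> A \<longrightarrow> emeasure M A = 1"
  proof (intro ballI impI)
    fix A assume "A \<in> sets M" "U \<subseteq> A"
    then have "1 \<le> emeasure M A"
      using 1 outer_measure_of_mono[of U A M] by simp
    then show "emeasure M A = 1"
      using measure_le_1 antisym by blast
  qed
next
  assume "\<forall>A\<in>sets M. U \<subseteq> A \<longrightarrow> emeasure M A = 1"
  then show "outer_measure_of M U = 1"
    using outer_measure_of_attain[OF assms] by auto
qed

text \<open>
  Induction on \<open>I\<close>, adding one coordinate: above a base point in \<open>U\<^sup>I\<close>, the section of a measurable
  superset of the larger power of \<open>U\<close> contains \<open>U\<close> and so has measure one. The base points with
  sections of measure one form a measurable set containing \<open>U\<^sup>I\<close>, which has measure one by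
  induction, and Fubini's theorem applies.
\<close>
lemma (in prob_space) outer_measure_of_PiM_PiE_eq_1:
  fixes I :: "'i set"
  assumes "finite I" and U: "U \<subseteq> space M" and one: "outer_measure_of M U = 1"
  shows "outer_measure_of (PiM I (\<lambda>_. M)) (I \<rightarrow>\<^sub>E U) = 1"
proof -
  interpret R: prob_space "PiM I (\<lambda>_. M)"
    by (intro prob_space_PiM prob_space_axioms)
  interpret PP: product_sigma_finite "\<lambda>_::'i. M"
    by standard
  have sub: "(I \<rightarrow>\<^sub>E U) \<subseteq> space (PiM I (\<lambda>_. M))" for I :: "'i set"
    using U by (auto simp: space_PiM PiE_iff)
  have "emeasure (PiM I (\<lambda>_. M)) A = 1"
    if "A \<in> sets (PiM I (\<lambda>_. M))" "(I \<rightarrow>\<^sub>E U) \<subseteq> A" for A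
    using \<open>finite I\<close> that
  proof (induction I arbitrary: A rule: finite_induct)
    case empty
    then have "A = space (PiM {} (\<lambda>_. M))"
      using sets.sets_into_space[OF empty.prems(1)] by (auto simp: space_PiM)
    then show ?case
      by (simp add: space_PiM)
  next
    case (insert i I)
    note [measurable] = insert.prems(1)
    let ?P = "PiM I (\<lambda>_. M)" and ?g = "\<lambda>x. \<integral>\<^sup>+ y. indicator A (x(i := y)) \<partial>M"
    interpret Q: prob_space ?P
      by (intro prob_space_PiM prob_space_axioms)
    have upd: "(\<lambda>(x, y). x(i := y)) \<in> ?P \<Otimes>\<^sub>M M \<rightarrow>\<^sub>M PiM (insert i I) (\<lambda>_. M)"
      by (rule measurable_add_dim)
    have [measurable]: "?g \<in> borel_measurable ?P"
      using measurable_compose[OF upd borel_measurable_indicator[OF insert.prems(1)]]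
      by (intro borel_measurable_nn_integral) (simp add: case_prod_beta')
    have "?g x = 1" if x: "x \<in> I \<rightarrow>\<^sub>E U" for x
    proof -
      have xP: "x \<in> space ?P"
        using x sub by blast
      let ?S = "{y \<in> space M. x(i := y) \<in> A}"
      have [measurable]: "(\<lambda>y. x(i := y)) \<in> M \<rightarrow>\<^sub>M PiM (insert i I) (\<lambda>_. M)"
        using measurable_compose[OF measurable_Pair1'[OF xP] upd] by simp
      have S: "?S \<in> sets M"
        by measurable
      have "U \<subseteq> ?S"
        using U insert.prems(2) PiE_fun_upd[OF _ x] by blast
      then have "emeasure M ?S = 1"
        using outer_measure_of_eq_1_iff[OF U] one S by blast
      moreover have "?g x = (\<integral>\<^sup>+ y. indicator ?S y \<partial>M)"
        by (intro nn_integral_cong) (simp add: indicator_def)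
      ultimately show ?thesis
        using S by simp
    qed
    then have "(I \<rightarrow>\<^sub>E U) \<subseteq> {x \<in> space ?P. ?g x = 1}"
      using sub by blast
    moreover have "{x \<in> space ?P. ?g x = 1} \<in> sets ?P"
      by measurable
    ultimately have "emeasure ?P {x \<in> space ?P. ?g x = 1} = 1"
      using insert.IH by blast
    then have "AE x in ?P. ?g x = 1"
      by (subst Q.AE_iff_emeasure_eq_1) auto
    then have "(\<integral>\<^sup>+ x. ?g x \<partial>?P) = (\<integral>\<^sup>+ x. 1 \<partial>?P)"
      by (rule nn_integral_cong_AE)
    also have "\<dots> = 1"
      by (simp add: Q.emeasure_space_1)
    finally show ?case
      using PP.product_nn_integral_insert[OF insert.hyps, of "indicator A"] insert.prems(1) by simp
  qed
  then show ?thesis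
    using R.outer_measure_of_eq_1_iff[OF sub] by blast
qed

section \<open>The counterexample\<close>

theorem mainTheorem2:
  "\<exists>(\<C> :: real set set) (L :: nat \<Rightarrow> (nat \<Rightarrow> real \<times> nat) \<Rightarrow> real set) (\<mu> :: real measure) (C :: real set).
     concept_class {0..1} \<C> \<and>
     (\<forall>H\<in>\<C>. H \<in> sets borel) \<and>
     VCdim {0..1} \<C> = 1 \<and>
     learning_rule {0..1} \<C> L \<and>
     consistent_rule {0..1} \<C> L \<and>
     prob_space \<mu> \<and>
     sets \<mu> = sets (restrict_space borel {0..1}) \<and>
     C \<in> \<C> \<and>
     (\<forall>n\<ge>1. outer_measure_of (PiM {1..n} (\<lambda>_. \<mu>))
        {s \<in> tuples n {0..1}. true_risk L C \<mu> n s = 1} = 1)"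
proof -
  let ?X = "{0..1} :: real set"
  define M where "M = restrict_space lborel ?X"
  have space_M: "space M = ?X"
    by (simp add: M_def space_restrict_space)
  have sets_M: "sets M = sets (restrict_space borel ?X)"
    by (simp add: M_def sets_restrict_space)
  have emeasure_M: "emeasure M ?X = 1"
    by (simp add: M_def emeasure_restrict_space)
  interpret M: finite_measure M
    by standard (simp add: space_M emeasure_M)
  have point: "{x} \<in> null_sets M" if "x \<in> space M" for x
    using that by (simp add: space_M) (simp add: M_def null_sets_restrict_space finite_imp_null_set_lborel)
  obtain K where K: "subset.chain (null_sets M) K"
    and K_not_null: "\<And>G. G \<in> null_sets M \<Longrightarrow> \<not> \<Union>K \<subseteq> G"
    using chain_null_sets_Union_not_null[of M] point by (auto simp: space_M emeasure_M)
  define U where "U = \<Union>K"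
  have K_null: "N \<in> null_sets M" "N \<subseteq> ?X" if "N \<in> K" for N
    using K that space_M sets.sets_into_space[of N M] by (auto simp: subset_chain_def)
  have U: "U \<subseteq> space M"
    using K_null space_M by (auto simp: U_def)
  obtain \<mu> where \<mu>: "prob_space \<mu>" "sets \<mu> = sets M" "null_sets M \<subseteq> null_sets \<mu>"
    and U_outer: "outer_measure_of \<mu> U = 1"
    using M.uniform_measure_hull[OF U] K_not_null U_def by blast
  interpret \<mu>: prob_space \<mu> by fact
  have space_\<mu>: "space \<mu> = ?X"
    using sets_eq_imp_space_eq[OF \<mu>(2)] space_M by simp

  define \<C> where "\<C> = insert {} ((\<lambda>N. ?X - N) ` K)"
  have prob_compl: "measure \<mu> (?X - N) = 1" if "N \<in> K" for N
  proof -
    have "N \<in> null_sets \<mu>"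
      using K_null(1)[OF that] \<mu>(3) by blast
    then have "measure \<mu> N = 0" "N \<in> \<mu>.events"
      by (auto simp: measure_def)
    then show ?thesis
      using \<mu>.prob_compl[of N] by (simp add: space_\<mu>)
  qed
  have compl_ne: "?X - N \<noteq> {}" if "N \<in> K" for N
    using prob_compl[OF that] by (metis measure_empty zero_neq_one)
  have chain_C: "subset.chain (Pow ?X) \<C>"
    using K unfolding subset_chain_def \<C>_def by fast
  have "K \<noteq> {}"
    using K_not_null[of "{}"] by auto
  then obtain N where N: "N \<in> K"
    by blast
  then obtain x where x: "x \<in> ?X - N"
    using compl_ne by blast
  have VC: "VCdim ?X \<C> = 1"
    by (rule VCdim_chain_eq_1[OF chain_C, of x "?X - N" "{}"]) (use x N in \<open>auto simp: \<C>_def\<close>)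

  have risk: "true_risk (nonempty_rule \<C>) {} \<mu> n s = 1"
    if s: "s \<in> {1..n} \<rightarrow>\<^sub>E U" for n s
  proof -
    have "finite (s ` {1..n})" "s ` {1..n} \<subseteq> \<Union>K"
      using s by (auto simp: U_def)
    then obtain N' where N': "N' \<in> K" "s ` {1..n} \<subseteq> N'"
      using finite_subset_Union_chain[OF _ _ \<open>K \<noteq> {}\<close> K] by blast
    let ?H = "nonempty_rule \<C> n (labeled_sample n {} s)"
    have "?X - N' \<in> \<C>" "?X - N' \<noteq> {}" "fits n (labeled_sample n {} s) (?X - N')"
      using N' compl_ne by (auto simp: \<C>_def fits_labeled_sample)
    then have "?H \<in> \<C>" "?H \<noteq> {}"
      by (rule nonempty_rule_fits)+
    \<comment> \<open>The chosen hypothesis need not be the complement of \<open>N'\<close>, but every nonempty member of the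
      class has full measure.\<close>
    then obtain N'' where "N'' \<in> K" "?H = ?X - N''"
      by (auto simp: \<C>_def)
    then show ?thesis
      using prob_compl by (simp add: true_risk_def)
  qed
  have outer: "outer_measure_of (PiM {1..n} (\<lambda>_. \<mu>))
      {s \<in> tuples n ?X. true_risk (nonempty_rule \<C>) {} \<mu> n s = 1} = 1" (is "outer_measure_of ?P ?S = 1")
    for n
  proof (rule antisym)
    interpret P: prob_space ?P
      by (intro prob_space_PiM \<mu>.prob_space_axioms)
    have "?S \<subseteq> space ?P"
      by (auto simp: tuples_def space_PiM space_\<mu>)
    then show "outer_measure_of ?P ?S \<le> 1"
      using outer_measure_of_mono[of ?S "space ?P" ?P]
      by (simp add: P.emeasure_space_1 del: One_nat_def)
    have "({1..n} \<rightarrow>\<^sub>E U) \<subseteq> ?S"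
      using risk U by (auto simp: tuples_def space_M PiE_iff)
    then show "1 \<le> outer_measure_of ?P ?S"
      using outer_measure_of_mono[of "{1..n} \<rightarrow>\<^sub>E U" ?S ?P] U
        \<mu>.outer_measure_of_PiM_PiE_eq_1[OF _ _ U_outer, of "{1..n}"]
      by (simp add: space_M space_\<mu> del: One_nat_def)
  qed
  have "N \<in> sets borel" if "N \<in> K" for N
    using K_null(1)[OF that] sets_M by (auto simp: null_sets_def sets_restrict_space_iff)
  then have borel: "H \<in> sets borel" if "H \<in> \<C>" for H
    using that by (auto simp: \<C>_def)
  have empty: "{} \<in> \<C>"
    by (simp add: \<C>_def)
  have concepts: "concept_class ?X \<C>"
    using chain_C by (simp add: concept_class_def subset_chain_def)
  have sets_\<mu>: "sets \<mu> = sets (restrict_space borel ?X)"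
    using \<mu>(2) sets_M by simp
  show ?thesis
    by (rule exI[of _ \<C>], rule exI[of _ "nonempty_rule \<C>"], rule exI[of _ \<mu>], rule exI[of _ "{}"])
      (intro conjI ballI allI impI concepts borel VC learning_rule_nonempty_rule
        consistent_nonempty_rule empty \<mu>(1) sets_\<mu> outer)
qed

end
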